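(* There exist at least two distinct families of pairs $(A_p,B_p)$, each indexed by all primes $p\ge 11$, such that for every prime $p\ge 11$ the sets $A_p,B_p\subset\mathbb{Z}_p$ are not arithmetic progressions, $|A_p|+|B_p|=p$, and $$|A_p\widehat{+}B_p|=p-2.$$
   Context: $\mathbb{Z}_p=\mathbb{Z}/p\mathbb{Z}$ is the cyclic group of order $p$. For nonempty $A,B\subset\mathbb{Z}_p$, the restricted sumset is $A\widehat{+}B=\{a+b: a\in A,\ b\in B,\ a\neq b\}$. A subset of $\mathbb{Z}_p$ of size $m$ is an arithmetic progression if it has the form $\{a_0+id: 0\le i\le m-1\}$ for some $a_0,d\in\mathbb{Z}_p$ with $d\neq 0$. *)

theory Defs
  imports "HOL-Number_Theory.Number_Theory"
begin

definition Zp :: "nat \<Rightarrow> int ring" where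
  "Zp p = residue_ring (int p)"

definition restricted_sumset :: "('a, 'm) ring_scheme \<Rightarrow> 'a set \<Rightarrow> 'a set \<Rightarrow> 'a set" where
  "restricted_sumset R A B = {a \<oplus>\<^bsub>R\<^esub> b | a b. a \<in> A \<and> b \<in> B \<and> a \<noteq> b}"

(* The number of terms is card S, so this is only meaningful for finite S. The empty set counts as
   a progression as soon as R has a nonzero element. *)
definition is_arith_prog :: "('a, 'm) ring_scheme \<Rightarrow> 'a set \<Rightarrow> bool" where
  "is_arith_prog R S \<longleftrightarrow>
     (\<exists>a\<^sub>0 \<in> carrier R. \<exists>d \<in> carrier R. d \<noteq> \<zero>\<^bsub>R\<^esub> \<and>
        S = {a\<^sub>0 \<oplus>\<^bsub>R\<^esub> [i] \<cdot>\<^bsub>R\<^esub> d | i :: nat. i < card S})"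

end

theory Submission
  imports Defs
begin

text \<open>
  A progression is carried to itself by a reflection \<open>x \<mapsto> s - x\<close>, and so is its complement, so it
  is enough to find sets that have no such symmetry. If \<open>A\<close> is the complement of \<open>C\<close>, then \<open>c\<close> is
  missing from the restricted sumset of \<open>A\<close> and \<open>B\<close> iff every \<open>b \<in> B\<close> satisfies \<open>c = 2b\<close> or
  \<open>c - b \<in> C\<close>. Let \<open>O\<close> be \<open>{1, 3}\<close> or \<open>{1, 3, 5}\<close>, \<open>B = {0} \<union> O\<close> and \<open>C = {2} \<union> -O\<close>: exactly
  \<open>c = 0\<close> and \<open>c = 2\<close> are missing, and since all the integers to be compared differ by less than 11, the congruences among them
  reduce to equalities.
\<close>

section \<open>Reflection symmetry of arithmetic progressions\<close>

lemma add_pow_residue_ring: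
  assumes "m > 1"
  shows "[i] \<cdot>\<^bsub>residue_ring m\<^esub> d = (int i * d) mod m"
proof -
  interpret residues m "residue_ring m"
    using assms by unfold_locales auto
  show ?thesis
    by (induction i)
      (simp_all add: add_pow_def nat_pow_def residue_ring_def algebra_simps mod_simps)
qed

text \<open>The reflection reverses the order of the terms, so \<open>s\<close> is the sum of the
  first and the last one.\<close>

lemma arith_prog_reflection:
  assumes "p > 1" and "is_arith_prog (Zp p) S"
  obtains s where "\<And>x. x \<in> S \<Longrightarrow> (s - x) mod int p \<in> S"
proof -
  define n where "n = card S"
  obtain a d where S: "S = {(a + int i * d) mod int p | i. i < n}"
    using assms unfolding is_arith_prog_def Zp_def n_def[symmetric]
    by (auto simp: add_pow_residue_ring) (auto simp: residue_ring_def mod_simps)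
  have "(2 * a + (int n - 1) * d - x) mod int p \<in> S" if x: "x \<in> S" for x
  proof -
    obtain i where i: "i < n" "x = (a + int i * d) mod int p"
      using x unfolding S by blast
    have "(2 * a + (int n - 1) * d) - (a + int i * d) = a + int (n - 1 - i) * d"
      using i(1) by (simp add: of_nat_diff algebra_simps)
    then have "(2 * a + (int n - 1) * d - x) mod int p = (a + int (n - 1 - i) * d) mod int p"
      by (metis i(2) mod_diff_right_eq)
    moreover have "n - 1 - i < n"
      using i(1) by simp
    ultimately show ?thesis
      unfolding S by blast
  qed
  then show thesis
    by (rule that)
qed

section \<open>Residues missing from a restricted sumset\<close>

lemma mod_mem_image_mod_iff:
  fixes m :: int
  shows "x mod m \<in> (\<lambda>x. x mod m) ` T \<longleftrightarrow> (\<exists>t\<in>T. [x = t] (mod m))"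
  by (auto simp: cong_def)

lemma restricted_sumset_complement:
  fixes p :: nat and B C :: "int set"
  defines "r \<equiv> \<lambda>x. x mod int p"
  assumes "p > 0"
  shows "restricted_sumset (Zp p) ({0..<int p} - r ` C) (r ` B)
    = {0..<int p} - {c. \<forall>b\<in>B. [c = 2 * b] (mod int p) \<or> (\<exists>y\<in>C. [c = b + y] (mod int p))}"
    (is "?L = ?R")
proof (rule Set.set_eqI)
  fix c
  have "c \<in> ?L \<longleftrightarrow> c \<in> {0..<int p} \<and>
      (\<exists>b\<in>B. r (c - b) \<notin> r ` C \<and> r (c - b) \<noteq> r b)"
  proof
    assume "c \<in> ?L"
    then obtain a b where ab: "a \<in> {0..<int p}" "a \<notin> r ` C" "b \<in> B" "a \<noteq> r b"
      "c = (a + r b) mod int p"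
      by (auto simp: restricted_sumset_def Zp_def residue_ring_def)
    then have "r (c - b) = a"
      by (simp add: r_def mod_simps)
    moreover have "c \<in> {0..<int p}"
      using ab(5) assms by simp
    ultimately show "c \<in> {0..<int p} \<and> (\<exists>b\<in>B. r (c - b) \<notin> r ` C \<and> r (c - b) \<noteq> r b)"
      using ab(2-4) by blast
  next
    assume R: "c \<in> {0..<int p} \<and> (\<exists>b\<in>B. r (c - b) \<notin> r ` C \<and> r (c - b) \<noteq> r b)"
    then obtain b where b: "b \<in> B" "r (c - b) \<notin> r ` C" "r (c - b) \<noteq> r b"
      by blast
    have "r (c - b) \<in> {0..<int p}"
      using assms by (auto simp: r_def)
    moreover have "c = (r (c - b) + r b) mod int p"
      using R by (simp add: r_def mod_simps)
    ultimately show "c \<in> ?L"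
      using b unfolding restricted_sumset_def Zp_def residue_ring_def by auto
  qed
  moreover have "r (c - b) \<in> r ` C \<longleftrightarrow> (\<exists>y\<in>C. [c = b + y] (mod int p))" for b
    unfolding r_def mod_mem_image_mod_iff
    by (auto simp: cong_iff_dvd_diff algebra_simps)
  moreover have "r (c - b) = r b \<longleftrightarrow> [c = 2 * b] (mod int p)" for b
    unfolding r_def by (auto simp: mod_eq_dvd_iff cong_iff_dvd_diff algebra_simps)
  ultimately show "c \<in> ?L \<longleftrightarrow> c \<in> ?R"
    by auto
qed

section \<open>Reduction to conditions on integer representatives\<close>

definition critical_pair :: "nat \<Rightarrow> int set \<times> int set \<Rightarrow> bool" where
  "critical_pair p = (\<lambda>(A, B).
     A \<subseteq> carrier (Zp p) \<and> B \<subseteq> carrier (Zp p) \<and>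
     A \<noteq> {} \<and> B \<noteq> {} \<and>
     \<not> is_arith_prog (Zp p) A \<and> \<not> is_arith_prog (Zp p) B \<and>
     card A + card B = p \<and>
     card (restricted_sumset (Zp p) A B) = p - 2)"

text \<open>Fixed sets of integer representatives, negative ones included, describe the pair for
  every \<open>p\<close> at once.\<close>

definition compl_pair :: "int set \<Rightarrow> int set \<Rightarrow> nat \<Rightarrow> int set \<times> int set" where
  "compl_pair B C p =
     ({0..<int p} - (\<lambda>x. x mod int p) ` C, (\<lambda>x. x mod int p) ` B)"

text \<open>The hypothesis says that no reflection maps \<open>T\<close> into itself modulo
  \<open>p\<close>. It settles both sets, because a reflection is an involution: if it preserves the
  complement, it preserves the set.\<close>

lemma not_arith_prog_image_mod:
  assumes "p > 1" and "\<not> (\<exists>s. \<forall>x\<in>T. \<exists>y\<in>T. [s = x + y] (mod int p))"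
  shows "\<not> is_arith_prog (Zp p) ((\<lambda>x. x mod int p) ` T)" (is "\<not> is_arith_prog _ (?r ` T)")
    and "\<not> is_arith_prog (Zp p) ({0..<int p} - (\<lambda>x. x mod int p) ` T)"
proof -
  have asym: "\<not> (\<forall>x\<in>T. (s - x) mod int p \<in> ?r ` T)" for s
    using assms(2) unfolding mod_mem_image_mod_iff
    by (auto simp: cong_iff_dvd_diff algebra_simps)
  show "\<not> is_arith_prog (Zp p) (?r ` T)"
  proof
    assume "is_arith_prog (Zp p) (?r ` T)"
    then obtain s where "\<And>x. x \<in> ?r ` T \<Longrightarrow> (s - x) mod int p \<in> ?r ` T"
      using arith_prog_reflection[OF assms(1)] by blast
    then have "(s - x mod int p) mod int p \<in> ?r ` T" if "x \<in> T" for x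
      using that by blast
    then show False
      using asym[of s] by (simp add: mod_simps)
  qed
  show "\<not> is_arith_prog (Zp p) ({0..<int p} - ?r ` T)"
  proof
    assume "is_arith_prog (Zp p) ({0..<int p} - ?r ` T)"
    then obtain s where s: "\<And>x. x \<in> {0..<int p} - ?r ` T
        \<Longrightarrow> (s - x) mod int p \<in> {0..<int p} - ?r ` T"
      using arith_prog_reflection[OF assms(1)] by blast
    have "(s - x) mod int p \<in> ?r ` T" if "x \<in> T" for x
    proof (rule ccontr)
      assume "(s - x) mod int p \<notin> ?r ` T"
      \<comment> \<open>Reflecting a second time gives back \<open>x\<close>, which would thus lie
        in the complement.\<close>
      then have "(s - (s - x) mod int p) mod int p \<in> {0..<int p} - ?r ` T"
        using assms(1) by (intro s DiffI) simp_all
      then have "x mod int p \<notin> ?r ` T"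
        by (simp add: mod_simps)
      then show False
        using that by blast
    qed
    then show False
      using asym by blast
  qed
qed

text \<open>What is left to check for a family is arithmetic with a few integers. Equal
  cardinalities give \<open>(p - card C) + card B = p\<close>, and the two missing residues give
  \<open>p - 2\<close>.\<close>

lemma critical_pair_compl_pair:
  assumes p: "p > 2" and fin: "finite B" "finite C" and ne: "B \<noteq> {}"
    and inj: "inj_on (\<lambda>x. x mod int p) B" "inj_on (\<lambda>x. x mod int p) C"
    and card: "card B = card C" "card C < p"
    and asym: "\<not> (\<exists>s. \<forall>x\<in>B. \<exists>y\<in>B. [s = x + y] (mod int p))"
      "\<not> (\<exists>s. \<forall>x\<in>C. \<exists>y\<in>C. [s = x + y] (mod int p))"
    and missing: "\<And>c. (\<forall>b\<in>B. [c = 2 * b] (mod int p) \<or> (\<exists>y\<in>C. [c = b + y] (mod int p)))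
      \<longleftrightarrow> [c = 0] (mod int p) \<or> [c = 2] (mod int p)"
  shows "critical_pair p (compl_pair B C p)"
proof -
  let ?r = "\<lambda>x. x mod int p"
  have carrier: "carrier (Zp p) = {0..<int p}"
    by (auto simp: Zp_def residue_ring_def)
  have sub: "?r ` B \<subseteq> {0..<int p}" "?r ` C \<subseteq> {0..<int p}"
    using p by auto
  have cardA: "card ({0..<int p} - ?r ` C) = p - card C"
    using sub fin by (simp add: card_Diff_subset card_image inj)
  have "restricted_sumset (Zp p) ({0..<int p} - ?r ` C) (?r ` B) = {0..<int p} - {0, 2}"
  proof -
    \<comment> \<open>As \<open>p > 2\<close>, both 0 and 2 are their own residues.\<close>
    have "{0..<int p} - {c. [c = 0] (mod int p) \<or> [c = 2] (mod int p)} = {0..<int p} - {0, 2}"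
      using p by (auto simp: cong_def dest: zdvd_imp_le)
    then show ?thesis
      using p restricted_sumset_complement[of p C B] unfolding missing by simp
  qed
  then have sumset: "card (restricted_sumset (Zp p) ({0..<int p} - ?r ` C) (?r ` B)) = p - 2"
    using p by (simp add: card_Diff_subset)
  have "{0..<int p} - ?r ` C \<noteq> {}"
    using cardA card by force
  then show ?thesis
    using sub cardA sumset p card ne not_arith_prog_image_mod[OF _ asym(1)]
      not_arith_prog_image_mod[OF _ asym(2)]
    by (simp add: critical_pair_def compl_pair_def carrier card_image inj)
qed

section \<open>Congruences between integers closer than the modulus\<close>

lemma cong_iff_eq_of_near:
  fixes m :: int
  assumes "[s = t] (mod m)" and "\<bar>t - n\<bar> < m"
  shows "[s = n] (mod m) \<longleftrightarrow> t = n"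
proof -
  have "[s = n] (mod m) \<longleftrightarrow> m dvd t - n"
    using assms(1) by (metis cong_iff_dvd_diff cong_sym cong_trans)
  also have "\<dots> \<longleftrightarrow> t = n"
    using assms(2) zdvd_not_zless[of "\<bar>t - n\<bar>" m] by auto
  finally show ?thesis .
qed

lemma inj_on_mod_of_near:
  fixes m :: int
  assumes "\<And>x y. x \<in> T \<Longrightarrow> y \<in> T \<Longrightarrow> \<bar>x - y\<bar> < m"
  shows "inj_on (\<lambda>x. x mod m) T"
  using assms cong_iff_eq_of_near[OF cong_refl] by (auto simp: inj_on_def cong_def)

text \<open>A reflection would send the fixed \<open>x\<close> to some \<open>y\<close>, so that
  \<open>s\<close> is \<open>x + y\<close> modulo \<open>m\<close>. For this \<open>y\<close> the
  element \<open>u\<close> has no image: \<open>x + y\<close> differs from each \<open>u + v\<close>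
  by a nonzero integer of absolute value below \<open>m\<close>.\<close>

lemma no_reflection_mod:
  fixes m :: int
  assumes "x \<in> T"
    and "\<forall>y\<in>T. \<exists>u\<in>T. \<forall>v\<in>T. x + y \<noteq> u + v \<and> \<bar>x + y - (u + v)\<bar> < m"
  shows "\<not> (\<exists>s. \<forall>x\<in>T. \<exists>y\<in>T. [s = x + y] (mod m))"
  using assms cong_iff_eq_of_near by metis

text \<open>Here \<open>T\<close> is the set \<open>O\<close> of the overview. The elements 0 and 1
  of \<open>B\<close> alone exclude every \<open>c\<close> other than 0 and 2.\<close>

lemma missing_residues:
  fixes m :: int
  assumes "1 \<in> T" and "\<And>x. x \<in> T \<Longrightarrow> x = 1 \<or> x - 2 \<in> T"
    and near: "\<And>x. x \<in> T \<Longrightarrow> - x \<noteq> 3 \<and> \<bar>- x - 3\<bar> < m"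
      "\<And>x y. x \<in> T \<Longrightarrow> y \<in> T \<Longrightarrow> - x \<noteq> 1 - y \<and> \<bar>- x - (1 - y)\<bar> < m"
  shows "(\<forall>b\<in>insert 0 T. [c = 2 * b] (mod m) \<or> (\<exists>y\<in>insert 2 (uminus ` T). [c = b + y] (mod m)))
    \<longleftrightarrow> [c = 0] (mod m) \<or> [c = 2] (mod m)" (is "?L \<longleftrightarrow> ?R")
proof
  assume ?L
  \<comment> \<open>This is the condition at \<open>b = 0\<close>: \<open>c\<close> is 0, 2 or the
    negative of an element of \<open>T\<close>.\<close>
  then consider "?R" | x where "x \<in> T" "[c = - x] (mod m)"
    by fastforce
  then show ?R
  proof cases
    case 2
    \<comment> \<open>The condition at \<open>b = 1\<close>; for \<open>c = - x\<close>, the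
      assumptions \<open>near\<close> rule out all but the first case.\<close>
    have "[c = 2] (mod m) \<or> [c = 3] (mod m) \<or> (\<exists>y\<in>T. [c = 1 - y] (mod m))"
      using bspec[OF \<open>?L\<close>, of 1] assms(1) by auto
    then show ?thesis
      using near[OF 2(1)] cong_iff_eq_of_near[OF 2(2)] by blast
  qed
next
  assume ?R
  then show ?L
  proof
    assume c: "[c = 0] (mod m)"
    have "\<exists>y\<in>insert 2 (uminus ` T). [c = x + y] (mod m)" if "x \<in> T" for x
      using c that by (intro bexI[of _ "- x"]) auto
    with c show ?L
      by simp
  next
    assume c: "[c = 2] (mod m)"
    have "[c = 2 * x] (mod m) \<or> (\<exists>y\<in>insert 2 (uminus ` T). [c = x + y] (mod m))" if x: "x \<in> T" for x
    \<comment> \<open>At 1 the sum 2 would need \<open>1 + 1\<close>, which the restriction forbids.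
      For any other \<open>x\<close> the partner \<open>2 - x\<close> is the negative of
      \<open>x - 2\<close>, hence in \<open>C\<close>.\<close>
    proof (cases "x = 1")
      case True
      then show ?thesis
        using c by simp
    next
      case False
      then have "2 - x \<in> uminus ` T"
        using assms(2)[OF x] by (auto intro!: image_eqI[of _ _ "x - 2"])
      then show ?thesis
        using c by (intro disjI2 bexI[of _ "2 - x"]) auto
    qed
    with c show ?L
      by simp
  qed
qed

section \<open>The two families\<close>

lemma critical_pair_three:
  assumes "p \<ge> 11"
  shows "critical_pair p (compl_pair {0, 1, 3} {2, -1, -3} p)"
proof (rule critical_pair_compl_pair)
  show "inj_on (\<lambda>x. x mod int p) {0, 1, 3}" "inj_on (\<lambda>x. x mod int p) {2, -1, -3}"
    using assms by (intro inj_on_mod_of_near; auto)+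
  show "\<not> (\<exists>s. \<forall>x\<in>{0, 1, 3}. \<exists>y\<in>{0, 1, 3}. [s = x + y] (mod int p))"
    by (rule no_reflection_mod[of 0]) (use assms in simp_all)
  show "\<not> (\<exists>s. \<forall>x\<in>{2, -1, -3}. \<exists>y\<in>{2, -1, -3}. [s = x + y] (mod int p))"
    by (rule no_reflection_mod[of "-1"]) (use assms in simp_all)
  have "(\<forall>b\<in>insert 0 {1, 3}. [c = 2 * b] (mod int p) \<or>
        (\<exists>y\<in>insert 2 (uminus ` {1, 3}). [c = b + y] (mod int p)))
      \<longleftrightarrow> [c = 0] (mod int p) \<or> [c = 2] (mod int p)" for c
    by (rule missing_residues) (use assms in auto)
  then show "(\<forall>b\<in>{0, 1, 3}. [c = 2 * b] (mod int p) \<or> (\<exists>y\<in>{2, -1, -3}. [c = b + y] (mod int p)))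
      \<longleftrightarrow> [c = 0] (mod int p) \<or> [c = 2] (mod int p)" for c
    by simp
qed (use assms in simp_all)

lemma critical_pair_four:
  assumes "p \<ge> 11"
  shows "critical_pair p (compl_pair {0, 1, 3, 5} {2, -1, -3, -5} p)"
proof (rule critical_pair_compl_pair)
  show "inj_on (\<lambda>x. x mod int p) {0, 1, 3, 5}" "inj_on (\<lambda>x. x mod int p) {2, -1, -3, -5}"
    using assms by (intro inj_on_mod_of_near; auto)+
  show "\<not> (\<exists>s. \<forall>x\<in>{0, 1, 3, 5}. \<exists>y\<in>{0, 1, 3, 5}. [s = x + y] (mod int p))"
    by (rule no_reflection_mod[of 0]) (use assms in simp_all)
  show "\<not> (\<exists>s. \<forall>x\<in>{2, -1, -3, -5}. \<exists>y\<in>{2, -1, -3, -5}. [s = x + y] (mod int p))"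
    \<comment> \<open>For \<open>y = -5\<close> only \<open>u = 2\<close> works, and the gap between
      \<open>2 + 2\<close> and \<open>-1 - 5\<close> is 10, so \<open>p \<ge> 11\<close> is just
      enough.\<close>
    by (rule no_reflection_mod[of "-1"]) (use assms in simp_all)
  have "(\<forall>b\<in>insert 0 {1, 3, 5}. [c = 2 * b] (mod int p) \<or>
        (\<exists>y\<in>insert 2 (uminus ` {1, 3, 5}). [c = b + y] (mod int p)))
      \<longleftrightarrow> [c = 0] (mod int p) \<or> [c = 2] (mod int p)" for c
    by (rule missing_residues) (use assms in auto)
  then show "(\<forall>b\<in>{0, 1, 3, 5}. [c = 2 * b] (mod int p) \<or>
        (\<exists>y\<in>{2, -1, -3, -5}. [c = b + y] (mod int p)))
      \<longleftrightarrow> [c = 0] (mod int p) \<or> [c = 2] (mod int p)" for c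
    by simp
qed (use assms in simp_all)

theorem theoremB:
  "\<exists>F G :: nat \<Rightarrow> int set \<times> int set. \<forall>p. prime p \<and> p \<ge> 11 \<longrightarrow>
     F p \<noteq> G p \<and>
     (\<forall>(A, B) \<in> {F p, G p}.
        A \<subseteq> carrier (Zp p) \<and> B \<subseteq> carrier (Zp p) \<and>
        A \<noteq> {} \<and> B \<noteq> {} \<and>
        \<not> is_arith_prog (Zp p) A \<and> \<not> is_arith_prog (Zp p) B \<and>
        card A + card B = p \<and>
        card (restricted_sumset (Zp p) A B) = p - 2)"
proof (intro exI allI impI conjI)
  let ?F = "compl_pair {0, 1, 3} {2, -1, -3}" and ?G = "compl_pair {0, 1, 3, 5} {2, -1, -3, -5}"
  fix p :: nat
  assume "prime p \<and> p \<ge> 11"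
  then have p: "p \<ge> 11" ..
  \<comment> \<open>The residues 0, 1, 3 and 5 are distinct for \<open>p \<ge> 11\<close>, so 5
    tells the families apart at every \<open>p\<close>.\<close>
  have "5 \<in> snd (?G p)" and "5 \<notin> snd (?F p)"
    using p by (simp_all add: compl_pair_def)
  then show "?F p \<noteq> ?G p"
    by metis
  show "\<forall>(A, B) \<in> {?F p, ?G p}.
        A \<subseteq> carrier (Zp p) \<and> B \<subseteq> carrier (Zp p) \<and>
        A \<noteq> {} \<and> B \<noteq> {} \<and>
        \<not> is_arith_prog (Zp p) A \<and> \<not> is_arith_prog (Zp p) B \<and>
        card A + card B = p \<and>
        card (restricted_sumset (Zp p) A B) = p - 2"
    using critical_pair_three[OF p] critical_pair_four[OF p] by (simp add: critical_pair_def)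
qed

end
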